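(* For every integer $n \ge 8$, the moduli space $\mathrm{Nonsol}(n)$ of indecomposable $n$-dimensional nonsoliton $\mathbb{N}$-graded nilpotent Lie algebras contains a one-parameter family; that is, there is a family $(\mu_s)_{s \in \mathbb{R}}$ of nilpotent Lie brackets on $\mathbb{R}^n$, depending continuously on $s$, such that for every $s\in\mathbb{R}$ the Lie algebra $\mathfrak{n}_{\mu_s} = (\mathbb{R}^n,\mu_s)$ is nilpotent, indecomposable, $\mathbb{N}$-graded and nonsoliton, and such that $\mathfrak{n}_{\mu_s}$ and $\mathfrak{n}_{\mu_t}$ are not isomorphic whenever $s \ne t$.
   Context: All Lie algebras are real and finite-dimensional. A Lie algebra is indecomposable if it cannot be written as the direct sum of two nontrivial ideals. A Lie algebra $\mathfrak{g}$ is $\mathbb{N}$-graded if $\mathfrak{g} = \bigoplus_{i \in \mathbb{N}} V_i$ as a vector space with $[V_i,V_j] \subseteq V_{i+j}$ for all $i,j$, where $\mathbb{N} = \{1,2,3,\dots\}$. Let $\mathfrak{n}$ be a nilpotent Lie algebra with inner product $Q$. The Ricci form is $$\mathrm{ric}(x,y) = -\tfrac12 \sum_{i=1}^n Q([x,x_i],[y,x_i]) + \tfrac14 \sum_{i,j=1}^n Q([x_i,x_j],x)\,Q([x_i,x_j],y),$$ where $\{x_i\}_{i=1}^n$ is a $Q$-orthonormal basis of $\mathfrak{n}$, and the Ricci endomorphism $\mathrm{Ric}$ is defined by $Q(\mathrm{Ric}(x),y) = \mathrm{ric}(x,y)$ for all $x,y\in\mathfrak{n}$. The inner product $Q$ is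 soliton if there is $\beta \in \mathbb{R}$ such that $\mathrm{Ric} - \beta\,\mathrm{Id}$ is a derivation of $\mathfrak{n}$. A Lie algebra is soliton if it admits a soliton inner product, and nonsoliton otherwise. Moduli space: nilpotent Lie brackets $\mu$ on $\mathbb{R}^n$ form a subset $X$ of the finite-dimensional real vector space $V=\wedge^2(\mathbb{R}^n)^* \otimes \mathbb{R}^n$ (with its usual topology), on which $GL_n(\mathbb{R})$ acts by $(g\cdot\mu)(x,y) = g\,\mu(g^{-1}x,g^{-1}y)$; orbits correspond to isomorphism classes. The quotient $\mathcal{N}_n = X/GL_n(\mathbb{R})$ has the quotient topology. $\widetilde{\mathcal{N}}_n \subseteq \mathcal{N}_n$ is the subspace of classes of $\mathbb{N}$-graded, indecomposable nilpotent Lie algebras, and $\mathrm{Nonsol}(n) \subseteq \widetilde{\mathcal{N}}_n$ is the subset of classes of nonsoliton Lie algebras. *)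

theory Defs
  imports "HOL-Analysis.Analysis"
begin

section \<open>Lie algebras as vector spaces with a bracket\<close>

definition lie_bracket :: "('a::real_vector \<Rightarrow> 'a \<Rightarrow> 'a) \<Rightarrow> bool" where
  "lie_bracket \<mu> \<longleftrightarrow> bilinear \<mu> \<and> (\<forall>x. \<mu> x x = 0) \<and>
     (\<forall>x y z. \<mu> x (\<mu> y z) + \<mu> y (\<mu> z x) + \<mu> z (\<mu> x y) = 0)"

primrec lower_central :: "('a::real_vector \<Rightarrow> 'a \<Rightarrow> 'a) \<Rightarrow> nat \<Rightarrow> 'a set" where
  "lower_central \<mu> 0 = UNIV"
| "lower_central \<mu> (Suc k) = span {\<mu> x y |x y. y \<in> lower_central \<mu> k}"

definition nilpotent_bracket :: "('a::real_vector \<Rightarrow> 'a \<Rightarrow> 'a) \<Rightarrow> bool" where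
  "nilpotent_bracket \<mu> \<longleftrightarrow> (\<exists>k. lower_central \<mu> k = {0})"

definition lie_ideal :: "('a::real_vector \<Rightarrow> 'a \<Rightarrow> 'a) \<Rightarrow> 'a set \<Rightarrow> bool" where
  "lie_ideal \<mu> I \<longleftrightarrow> subspace I \<and> (\<forall>x. \<forall>y\<in>I. \<mu> x y \<in> I)"

definition indecomposable :: "('a::real_vector \<Rightarrow> 'a \<Rightarrow> 'a) \<Rightarrow> bool" where
  "indecomposable \<mu> \<longleftrightarrow>
     \<not> (\<exists>I J. lie_ideal \<mu> I \<and> lie_ideal \<mu> J \<and> I \<noteq> {0} \<and> J \<noteq> {0} \<and>
          I \<inter> J = {0} \<and> {x + y |x y. x \<in> I \<and> y \<in> J} = UNIV)"

definition direct_sum_decomposition :: "'i set \<Rightarrow> ('i \<Rightarrow> 'a::real_vector set) \<Rightarrow> bool" where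
  "direct_sum_decomposition I V \<longleftrightarrow> (\<forall>i\<in>I. subspace (V i)) \<and>
     (\<forall>x. \<exists>!v. (\<forall>i\<in>I. v i \<in> V i) \<and> (\<forall>i. i \<notin> I \<longrightarrow> v i = 0) \<and>
        finite {i. v i \<noteq> 0} \<and> x = (\<Sum>i | v i \<noteq> 0. v i))"

text \<open>Degrees are positive: there is no component of degree 0.\<close>

definition positively_graded :: "('a::real_vector \<Rightarrow> 'a \<Rightarrow> 'a) \<Rightarrow> bool" where
  "positively_graded \<mu> \<longleftrightarrow>
     (\<exists>V :: nat \<Rightarrow> 'a set. direct_sum_decomposition {1..} V \<and>
        (\<forall>i\<ge>1. \<forall>j\<ge>1. \<forall>x\<in>V i. \<forall>y\<in>V j. \<mu> x y \<in> V (i + j)))"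

definition derivation :: "('a::real_vector \<Rightarrow> 'a \<Rightarrow> 'a) \<Rightarrow> ('a \<Rightarrow> 'a) \<Rightarrow> bool" where
  "derivation \<mu> D \<longleftrightarrow> linear D \<and> (\<forall>x y. D (\<mu> x y) = \<mu> (D x) y + \<mu> x (D y))"

definition lie_isomorphic ::
  "('a::real_vector \<Rightarrow> 'a \<Rightarrow> 'a) \<Rightarrow> ('b::real_vector \<Rightarrow> 'b \<Rightarrow> 'b) \<Rightarrow> bool" where
  "lie_isomorphic \<mu> \<nu> \<longleftrightarrow>
     (\<exists>g. linear g \<and> bij g \<and> (\<forall>x y. g (\<mu> x y) = \<nu> (g x) (g y)))"

section \<open>Soliton inner products\<close>

text \<open>
  The inner product \<open>Q\<close> is arbitrary and unrelated to the inner product of the type class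
  \<^class>\<open>real_inner\<close>.
\<close>

definition inner_product :: "('a::real_vector \<Rightarrow> 'a \<Rightarrow> real) \<Rightarrow> bool" where
  "inner_product Q \<longleftrightarrow> bilinear Q \<and> (\<forall>x y. Q x y = Q y x) \<and> (\<forall>x. x \<noteq> 0 \<longrightarrow> Q x x > 0)"

definition orthonormal_basis :: "('a::real_vector \<Rightarrow> 'a \<Rightarrow> real) \<Rightarrow> 'a set \<Rightarrow> bool" where
  "orthonormal_basis Q B \<longleftrightarrow> finite B \<and> span B = UNIV \<and>
     (\<forall>x\<in>B. \<forall>y\<in>B. Q x y = (if x = y then 1 else 0))"

definition ricci_form ::
  "('a::real_vector \<Rightarrow> 'a \<Rightarrow> 'a) \<Rightarrow> ('a \<Rightarrow> 'a \<Rightarrow> real) \<Rightarrow> 'a set \<Rightarrow> 'a \<Rightarrow> 'a \<Rightarrow> real" where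
  "ricci_form \<mu> Q B x y =
     - (1/2) * (\<Sum>b\<in>B. Q (\<mu> x b) (\<mu> y b))
     + (1/4) * (\<Sum>b\<in>B. \<Sum>c\<in>B. Q (\<mu> b c) x * Q (\<mu> b c) y)"

lemma orthonormal_basis_expansion:
  assumes Q: "inner_product Q" and B: "orthonormal_basis Q B"
  shows "x = (\<Sum>b\<in>B. Q x b *\<^sub>R b)"
proof -
  have fin: "finite B" and lin: "\<And>z. linear (\<lambda>w. Q w z)"
    using Q B by (auto simp: inner_product_def orthonormal_basis_def bilinear_def)
  have "x \<in> span B" using B by (simp add: orthonormal_basis_def)
  then show ?thesis
  proof (induction rule: span_induct_alt)
    case base
    show ?case using linear_0[OF lin] by simp
  next
    case (step c b y)
    have 1: "Q (c *\<^sub>R b + y) b' = c * Q b b' + Q y b'" for b'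
      by (simp add: linear_add[OF lin] linear_scale[OF lin])
    have "(\<Sum>b'\<in>B. Q b b' *\<^sub>R b') = (\<Sum>b'\<in>B. if b' = b then b' else 0)"
      using B step(1) by (intro sum.cong) (auto simp: orthonormal_basis_def)
    also have "\<dots> = b" using fin step(1) by simp
    finally have 2: "(\<Sum>b'\<in>B. Q b b' *\<^sub>R b') = b" .
    have "(\<Sum>b'\<in>B. Q (c *\<^sub>R b + y) b' *\<^sub>R b')
        = c *\<^sub>R (\<Sum>b'\<in>B. Q b b' *\<^sub>R b') + (\<Sum>b'\<in>B. Q y b' *\<^sub>R b')"
      by (simp add: 1 scaleR_left_distrib sum.distrib scaleR_sum_right)
    then show ?case using 2 step(2) by simp
  qed
qed

lemma trace_orthonormal_basis:
  fixes h :: "'a::real_vector \<Rightarrow> 'a \<Rightarrow> real"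
  assumes Q: "inner_product Q" and B: "orthonormal_basis Q B" and C: "orthonormal_basis Q C"
    and h: "bilinear h"
  shows "(\<Sum>c\<in>C. h c c) = (\<Sum>b\<in>B. h b b)"
proof -
  have l1: "linear (\<lambda>x. h x z)" and l2: "linear (h z)" for z
    using h by (auto simp: bilinear_def)
  have "(\<Sum>c\<in>C. h c c) = (\<Sum>c\<in>C. h (\<Sum>b\<in>B. Q c b *\<^sub>R b) c)"
    using orthonormal_basis_expansion[OF Q B] by simp
  also have "\<dots> = (\<Sum>c\<in>C. \<Sum>b\<in>B. Q c b * h b c)"
    by (simp add: linear_sum[OF l1] linear_scale[OF l1])
  also have "\<dots> = (\<Sum>b\<in>B. \<Sum>c\<in>C. Q b c * h b c)"
    using Q by (subst sum.swap) (simp add: inner_product_def)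
  also have "\<dots> = (\<Sum>b\<in>B. h b (\<Sum>c\<in>C. Q b c *\<^sub>R c))"
    by (simp add: linear_sum[OF l2] linear_scale[OF l2])
  also have "\<dots> = (\<Sum>b\<in>B. h b b)"
    using orthonormal_basis_expansion[OF Q C] by simp
  finally show ?thesis .
qed

text \<open>The Ricci form does not depend on the orthonormal basis.\<close>

lemma ricci_form_basis_independent:
  assumes \<mu>: "bilinear \<mu>" and Q: "inner_product Q"
    and B: "orthonormal_basis Q B" and C: "orthonormal_basis Q C"
  shows "ricci_form \<mu> Q C x y = ricci_form \<mu> Q B x y"
proof -
  have l: "linear (\<lambda>w. \<mu> w z)" "linear (\<mu> z)" for z
    using \<mu> by (auto simp: bilinear_def)
  have lQ: "linear (\<lambda>w. Q w z)" "linear (Q z)" for z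
    using Q by (auto simp: bilinear_def inner_product_def)
  note lins = linear_add[OF l(1)] linear_add[OF l(2)] linear_add[OF lQ(1)] linear_add[OF lQ(2)]
    linear_scale[OF l(1)] linear_scale[OF l(2)] linear_scale[OF lQ(1)] linear_scale[OF lQ(2)]
  have b1: "bilinear (\<lambda>b c. Q (\<mu> x b) (\<mu> y c))"
    by (auto simp: bilinear_def lins intro!: linearI)
  have b2: "bilinear (\<lambda>b b'. Q (\<mu> b c) x * Q (\<mu> b' c) y)" for c
    by (auto simp: bilinear_def lins algebra_simps intro!: linearI)
  have b3: "bilinear (\<lambda>c c'. Q (\<mu> b c) x * Q (\<mu> b c') y)" for b
    by (auto simp: bilinear_def lins algebra_simps intro!: linearI)
  have "(\<Sum>b\<in>C. \<Sum>c\<in>C. Q (\<mu> b c) x * Q (\<mu> b c) y)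
      = (\<Sum>b\<in>C. \<Sum>c\<in>B. Q (\<mu> b c) x * Q (\<mu> b c) y)"
    by (intro sum.cong refl trace_orthonormal_basis[OF Q B C b3])
  also have "\<dots> = (\<Sum>c\<in>B. \<Sum>b\<in>C. Q (\<mu> b c) x * Q (\<mu> b c) y)"
    by (rule sum.swap)
  also have "\<dots> = (\<Sum>c\<in>B. \<Sum>b\<in>B. Q (\<mu> b c) x * Q (\<mu> b c) y)"
    by (intro sum.cong refl trace_orthonormal_basis[OF Q B C b2])
  also have "\<dots> = (\<Sum>b\<in>B. \<Sum>c\<in>B. Q (\<mu> b c) x * Q (\<mu> b c) y)"
    by (rule sum.swap)
  finally show ?thesis
    using trace_orthonormal_basis[OF Q B C b1] by (simp add: ricci_form_def)
qed

text \<open>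
  Since \<open>Q\<close> is nondegenerate, at most one \<open>R\<close> satisfies this.
\<close>

definition ricci_endomorphism ::
  "('a::real_vector \<Rightarrow> 'a \<Rightarrow> 'a) \<Rightarrow> ('a \<Rightarrow> 'a \<Rightarrow> real) \<Rightarrow> ('a \<Rightarrow> 'a) \<Rightarrow> bool" where
  "ricci_endomorphism \<mu> Q R \<longleftrightarrow>
     (\<exists>B. orthonormal_basis Q B \<and> (\<forall>x y. Q (R x) y = ricci_form \<mu> Q B x y))"

definition soliton_inner_product ::
  "('a::real_vector \<Rightarrow> 'a \<Rightarrow> 'a) \<Rightarrow> ('a \<Rightarrow> 'a \<Rightarrow> real) \<Rightarrow> bool" where
  "soliton_inner_product \<mu> Q \<longleftrightarrow> inner_product Q \<and>
     (\<exists>R \<beta>. ricci_endomorphism \<mu> Q R \<and> derivation \<mu> (\<lambda>x. R x - \<beta> *\<^sub>R x))"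

definition soliton :: "('a::real_vector \<Rightarrow> 'a \<Rightarrow> 'a) \<Rightarrow> bool" where
  "soliton \<mu> \<longleftrightarrow> (\<exists>Q. soliton_inner_product \<mu> Q)"

section \<open>The space of brackets\<close>

text \<open>
  Brackets that vary in a parameter are elements of the normed space of bounded bilinear maps.
  In finite dimension this is the space of all bilinear maps, and the alternating maps form a
  linear subspace of it; so the norm topology induces the usual topology on them.
\<close>

abbreviation bracket_of ::
  "('a::real_normed_vector \<Rightarrow>\<^sub>L 'a \<Rightarrow>\<^sub>L 'a) \<Rightarrow> 'a \<Rightarrow> 'a \<Rightarrow> 'a" where
  "bracket_of m \<equiv> (\<lambda>x y. blinfun_apply (blinfun_apply m x) y)"

end

theory Submission
  imports Defs
begin

text \<open>
  In dimension \<open>N \<ge> 8\<close> the family is given on a basis \<open>e1, ..., eN\<close> by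

  \<^item> \<open>[e1, ei] = e(i+1)\<close> for \<open>2 \<le> i \<le> 6\<close>,
  \<^item> \<open>[e2, e3] = e5 + e8\<close>, \<open>[e2, e4] = e6\<close>, \<open>[e2, e5] = (1 - s) e7\<close>, \<open>[e3, e4] = s e7\<close>,
  \<^item> \<open>[e1, ei] = e(i+1)\<close> for \<open>9 \<le> i < N\<close>, and in dimension 9 only also \<open>[e2, e9] = e7\<close>.

  On \<open>e1, ..., e7\<close>, modulo \<open>e8\<close>, this is the classical one-parameter family of filiform algebras
  graded by \<open>1, 2, ..., 7\<close>.  Its parameter survives: an isomorphism acts on the classes of \<open>e1, e2\<close>, up to
  higher terms, by scalars \<open>a, b\<close>; since \<open>e8 = [e2, e3] - [e1, e4]\<close> is central, \<open>b = a^2\<close>, and then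
  both \<open>[e3, e4]\<close> and \<open>e7\<close> are scaled by \<open>a^7\<close>, so \<open>s\<close> is an invariant.

  The vector \<open>e8\<close>, of weight 5, is what prevents a soliton.  It is central and lies in the span of
  the brackets, so every inner product gives it (after a correction within the centre) positive Ricci
  curvature.  Suppose now that \<open>Ric - \<beta> Id\<close> is a derivation \<open>D\<close>.  Every derivation has eigenvalue
  \<open>\<delta>\<close> times the weight on \<open>e1, ..., e8\<close> for some \<open>\<delta>\<close>, modulo a flag, so that
  \<open>5 \<delta> + \<beta> > 0\<close>.  On the other hand \<open>Ric\<close> is trace-orthogonal to all derivations, in particular
  to the one that multiplies by the weights.  For \<open>N = 8\<close> the weights \<open>1, 2, 3, 4, 5, 6, 7, 5\<close> have
  sum 33 and sum of squares \<open>165 = 5 * 33\<close>, so that \<open>33 \<beta> + 165 \<delta> = 0\<close>, that is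
  \<open>5 \<delta> + \<beta> = 0\<close>: a contradiction.  The chain \<open>e9, ..., eN\<close> serves to reach all larger dimensions.
  It has weights \<open>\<ge> 5\<close> and can only increase the ratio of the coefficients of \<open>\<delta>\<close> and \<open>\<beta>\<close> above
  5, which makes \<open>5 \<delta> + \<beta>\<close> nonpositive once \<open>\<delta> > 0\<close> is known; the latter holds because the direction orthogonal to the
  span of \<open>e2, ..., eN\<close>, where \<open>D\<close> has eigenvalue \<open>\<delta>\<close>, has nonpositive Ricci curvature.

  The inner product is arbitrary and need not be adapted to the basis.  It enters through the trace
  identity \<open>ricci_form_derivation_trace\<close>, the two sign statements on the Ricci form that follow it,
  and \<open>orthogonal_representative\<close>, which extracts the eigenvalue of a derivation on a quotient.
\<close>

section \<open>Ricci curvature of a metric Lie algebra\<close>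

lemma inner_product_linear:
  assumes "inner_product Q"
  shows "linear (\<lambda>x. Q x y)" and "linear (Q x)"
  using assms by (auto simp: inner_product_def bilinear_def)

lemma inner_product_sym: "inner_product Q \<Longrightarrow> Q x y = Q y x"
  by (auto simp: inner_product_def)

lemma inner_product_pos: "inner_product Q \<Longrightarrow> x \<noteq> 0 \<Longrightarrow> 0 < Q x x"
  by (auto simp: inner_product_def)

lemma orthonormal_basis_span: "orthonormal_basis Q B \<Longrightarrow> span B = UNIV"
  by (simp add: orthonormal_basis_def)

lemma orthogonal_projection_exists:
  assumes Q: "inner_product Q" and "finite S"
  shows "\<exists>k\<in>span S. \<forall>y\<in>span S. Q (v - k) y = 0"
  using \<open>finite S\<close>
proof (induction S arbitrary: v rule: finite_induct)
  case empty
  show ?case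
    using linear_0[OF inner_product_linear(2)[OF Q]] by auto
next
  case (insert a S)
  note lin = inner_product_linear[OF Q]
  obtain k where k: "k \<in> span S" "\<And>y. y \<in> span S \<Longrightarrow> Q (v - k) y = 0"
    using insert.IH by blast
  obtain l where l: "l \<in> span S" "\<And>y. y \<in> span S \<Longrightarrow> Q (a - l) y = 0"
    using insert.IH by blast
  \<comment> \<open>If \<open>a\<close> already lies in \<open>span S\<close>, then \<open>a - l = 0\<close> and the division by zero makes \<open>c = 0\<close>.\<close>
  define c where "c = Q (v - k) (a - l) / Q (a - l) (a - l)"
  define k' where "k' = k + c *\<^sub>R (a - l)"
  have sub: "span S \<subseteq> span (insert a S)"
    by (intro span_mono) auto
  have al: "a - l \<in> span (insert a S)"
    using l(1) sub by (meson insertI1 span_base span_diff subsetD)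
  have "k' \<in> span (insert a S)"
    using k(1) sub al by (auto simp: k'_def intro!: span_add span_scale)
  moreover have "Q (v - k') y = 0" if y_in: "y \<in> span (insert a S)" for y
  proof -
    obtain d where d: "y - d *\<^sub>R a \<in> span S"
      using y_in unfolding span_breakdown_eq by blast
    define w where "w = y - d *\<^sub>R a + d *\<^sub>R l"
    have w: "w \<in> span S"
      using d l(1) by (auto simp: w_def intro!: span_add span_scale)
    have y: "y = w + d *\<^sub>R (a - l)"
      by (simp add: w_def algebra_simps)
    have "Q (v - k) (a - l) - c * Q (a - l) (a - l) = 0"
    proof (cases "a - l = 0")
      case True
      then show ?thesis
        using linear_0[OF lin(2)] by simp
    next
      case False
      then show ?thesis
        using inner_product_pos[OF Q False] by (simp add: c_def)
    qed
    moreover have "Q (v - k') z = Q (v - k) z - c * Q (a - l) z" for z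
      unfolding k'_def diff_diff_eq[symmetric]
      by (simp only: linear_diff[OF lin(1), of "v - k"] linear_scale[OF lin(1)] real_scaleR_def)
    ultimately show ?thesis
      using k(2)[OF w] l(2)[OF w]
      by (simp only: y linear_add[OF lin(2)] linear_scale[OF lin(2)] real_scaleR_def)
  qed
  ultimately show ?case by blast
qed

text \<open>
  A linear map that acts by the scalar \<open>\<delta>\<close> on the line of \<open>v\<close> modulo an invariant subspace need not
  have an eigenvector in \<open>v + K\<close>, but the representative orthogonal to \<open>K\<close> sees only \<open>\<delta>\<close>.
\<close>

lemma orthogonal_representative:
  fixes Q :: "'a::euclidean_space \<Rightarrow> 'a \<Rightarrow> real"
  assumes Q: "inner_product Q" and D: "linear D" and K: "subspace K"
    and inv: "\<And>x. x \<in> K \<Longrightarrow> D x \<in> K" and v: "D v - \<delta> *\<^sub>R v \<in> K"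
  obtains f where "v - f \<in> K" and "\<And>y. y \<in> K \<Longrightarrow> Q f y = 0" and "Q (D f) f = \<delta> * Q f f"
proof -
  obtain S where "finite S" "span S = K"
    using basis_exists[of K] K span_subspace independent_imp_finite by metis
  then obtain k where k: "k \<in> K" "\<And>y. y \<in> K \<Longrightarrow> Q (v - k) y = 0"
    using orthogonal_projection_exists[OF Q, of S v] by blast
  define f where "f = v - k"
  have "D f - \<delta> *\<^sub>R f = (D v - \<delta> *\<^sub>R v) - D k + \<delta> *\<^sub>R k"
    by (simp add: f_def linear_diff[OF D] algebra_simps)
  also have "\<dots> \<in> K"
    using v inv[OF k(1)] k(1) K by (auto intro!: subspace_add subspace_diff subspace_scale)
  finally have "Q f (D f - \<delta> *\<^sub>R f) = 0"
    using k(2) by (simp add: f_def)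
  then have "Q (D f) f = \<delta> * Q f f"
    using inner_product_sym[OF Q, of f "D f"]
    by (simp add: linear_diff[OF inner_product_linear(2)[OF Q]]
        linear_scale[OF inner_product_linear(2)[OF Q]])
  then show ?thesis
    using that[of f] k by (simp add: f_def)
qed

lemma alternating_antisym:
  assumes "bilinear \<mu>" and "\<And>x. \<mu> x x = 0"
  shows "\<mu> x y = - \<mu> y x"
proof -
  have "\<mu> (x + y) (x + y) = 0" by (rule assms)
  then have "\<mu> x y + \<mu> y x = 0"
    using assms(2)[of x] assms(2)[of y]
    by (simp add: bilinear_ladd[OF assms(1)] bilinear_radd[OF assms(1)] add.commute)
  then show ?thesis by (simp add: eq_neg_iff_add_eq_0)
qed

text \<open>
  The Ricci endomorphism is orthogonal to every derivation under the trace form: up to a factor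
  \<open>Ric\<close> is the moment map of the action of the general linear group on brackets, and the derivations
  span the stabiliser of \<open>\<mu>\<close>.  Concretely, the first sum in the Ricci form pairs \<open>\<mu> b c\<close> with
  \<open>\<mu> (W b) c\<close>, the second pairs it with \<open>W (\<mu> b c) = \<mu> (W b) c + \<mu> b (W c)\<close>, and by antisymmetry
  the latter gives twice the former.
\<close>

lemma ricci_form_derivation_trace:
  assumes \<mu>: "bilinear \<mu>" and alt: "\<And>x. \<mu> x x = 0" and Q: "inner_product Q"
    and B: "orthonormal_basis Q B" and W: "derivation \<mu> W"
  shows "(\<Sum>b\<in>B. ricci_form \<mu> Q B (W b) b) = 0"
proof -
  note lin = inner_product_linear[OF Q]
  have linW: "linear W" and der: "\<And>x y. W (\<mu> x y) = \<mu> (W x) y + \<mu> x (W y)"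
    using W by (auto simp: derivation_def)
  have anti: "\<mu> x y = - \<mu> y x" for x y
    using alternating_antisym[OF \<mu> alt] .
  have inner: "(\<Sum>b\<in>B. Q v (W b) * Q v b) = Q v (W v)" for v
  proof -
    have "Q v (W v) = Q v (W (\<Sum>b\<in>B. Q v b *\<^sub>R b))"
      using orthonormal_basis_expansion[OF Q B, of v] by simp
    also have "\<dots> = (\<Sum>b\<in>B. Q v b * Q v (W b))"
      by (simp add: linear_sum[OF linW] linear_scale[OF linW] linear_sum[OF lin(2)]
          linear_scale[OF lin(2)])
    finally show ?thesis by (simp add: mult.commute)
  qed
  define A where "A = (\<Sum>b\<in>B. \<Sum>c\<in>B. Q (\<mu> (W b) c) (\<mu> b c))"
  have "(\<Sum>b\<in>B. \<Sum>c\<in>B. \<Sum>d\<in>B. Q (\<mu> c d) (W b) * Q (\<mu> c d) b)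
      = (\<Sum>c\<in>B. \<Sum>d\<in>B. \<Sum>b\<in>B. Q (\<mu> c d) (W b) * Q (\<mu> c d) b)"
    by (subst sum.swap, rule sum.cong[OF refl], subst sum.swap, rule refl)
  also have "\<dots> = (\<Sum>c\<in>B. \<Sum>d\<in>B. Q (\<mu> c d) (\<mu> (W c) d) + Q (\<mu> c d) (\<mu> c (W d)))"
    by (simp add: inner der linear_add[OF lin(2)])
  also have "\<dots> = A + (\<Sum>c\<in>B. \<Sum>d\<in>B. Q (\<mu> c d) (\<mu> c (W d)))"
    using inner_product_sym[OF Q] by (simp add: sum.distrib A_def)
  also have "(\<Sum>c\<in>B. \<Sum>d\<in>B. Q (\<mu> c d) (\<mu> c (W d))) = (\<Sum>d\<in>B. \<Sum>c\<in>B. Q (\<mu> c d) (\<mu> c (W d)))"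
    by (rule sum.swap)
  also have "\<dots> = A"
    unfolding A_def
  proof (intro sum.cong refl)
    fix d c
    have "Q (\<mu> c d) (\<mu> c (W d)) = Q (- \<mu> d c) (- \<mu> (W d) c)"
      using anti[of c d] anti[of c "W d"] by simp
    then show "Q (\<mu> c d) (\<mu> c (W d)) = Q (\<mu> (W d) c) (\<mu> d c)"
      using inner_product_sym[OF Q] by (simp add: linear_neg[OF lin(1)] linear_neg[OF lin(2)])
  qed
  finally show ?thesis
    by (simp add: ricci_form_def sum_subtractf A_def flip: sum_divide_distrib)
qed

text \<open>
  For a central vector only the positive sum of the Ricci form survives.  It is a sum of squares,
  which vanishes only if all brackets are orthogonal to the vector.
\<close>

lemma ricci_form_central_pos:
  assumes \<mu>: "bilinear \<mu>" and Q: "inner_product Q" and B: "orthonormal_basis Q B"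
    and central: "\<And>y. \<mu> f y = 0" and nz: "Q (\<mu> x y) f \<noteq> 0"
  shows "0 < ricci_form \<mu> Q B f f"
proof -
  note lin = inner_product_linear[OF Q]
  have fin: "finite B" using B by (simp add: orthonormal_basis_def)
  have "\<exists>b\<in>B. \<exists>c\<in>B. Q (\<mu> b c) f \<noteq> 0"
  proof (rule ccontr)
    assume "\<not> ?thesis"
    then have z: "Q (\<mu> b c) f = 0" if "b \<in> B" "c \<in> B" for b c
      using that by blast
    have l1: "linear (\<lambda>u. Q (\<mu> u v) f)" and l2: "linear (\<lambda>u. Q (\<mu> v u) f)" for v
      using \<mu> linear_compose[OF _ lin(1), of _ f] by (auto simp: bilinear_def o_def)
    have "Q (\<mu> u c) f = 0" if "c \<in> B" for u c
      using linear_eq_0_on_span[OF l1, of B c u] z that orthonormal_basis_span[OF B] by auto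
    then have "Q (\<mu> x y) f = 0"
      using linear_eq_0_on_span[OF l2, of B x y] orthonormal_basis_span[OF B] by auto
    then show False using nz by contradiction
  qed
  then obtain b c where bc: "b \<in> B" "c \<in> B" "Q (\<mu> b c) f \<noteq> 0" by blast
  have "0 < (\<Sum>c\<in>B. Q (\<mu> b c) f * Q (\<mu> b c) f)"
    using bc fin by (intro sum_pos2[of _ c]) (auto simp: zero_less_mult_iff linorder_neq_iff)
  then have "0 < (\<Sum>b\<in>B. \<Sum>c\<in>B. Q (\<mu> b c) f * Q (\<mu> b c) f)"
    by (rule sum_pos2[OF fin bc(1)]) (auto intro!: sum_nonneg)
  then show ?thesis
    by (simp add: ricci_form_def central linear_0[OF lin(1)])
qed

text \<open>Orthogonality to all brackets kills the positive sum instead.\<close>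

lemma ricci_form_orthogonal_nonpos:
  assumes Q: "inner_product Q" and orth: "\<And>x y. Q (\<mu> x y) f = 0"
  shows "ricci_form \<mu> Q B f f \<le> 0"
proof -
  have "0 \<le> Q v v" for v
    using inner_product_pos[OF Q, of v] linear_0[OF inner_product_linear(1)[OF Q]]
    by (cases "v = 0") auto
  then show ?thesis
    by (simp add: ricci_form_def orth sum_nonneg)
qed

section \<open>The family of brackets\<close>

text \<open>Keeping \<open>1\<close> as a numeral lets the coordinate rules below be stated uniformly in the index.\<close>

declare One_nat_def [simp del]

locale enumerated_axes =
  fixes N :: nat and ax :: "nat \<Rightarrow> 'n::finite"
  assumes ax: "bij_betw ax {1..N} UNIV" and dim: "8 \<le> N"
begin

text \<open>
  Coordinates and basis vectors are zero outside the range \<open>1..N\<close>, so that formulas which mention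
  the ninth basis vector make sense, and are true, in dimension 8.
\<close>

definition co :: "nat \<Rightarrow> real ^ 'n \<Rightarrow> real" where
  "co k x = (if k \<in> {1..N} then x $ ax k else 0)"

definition ee :: "nat \<Rightarrow> real ^ 'n" where
  "ee k = (if k \<in> {1..N} then axis (ax k) 1 else 0)"

definition vec_of :: "(nat \<Rightarrow> real) \<Rightarrow> real ^ 'n" where
  "vec_of f = (\<chi> i. f (inv_into {1..N} ax i))"

lemma le_N [simp]: "k \<le> 8 \<Longrightarrow> k \<le> N"
  using dim by simp

lemma N_neq [simp]: "k < 8 \<Longrightarrow> N \<noteq> k"
  using dim by linarith

lemma co_outside [simp]: "\<not> k \<le> N \<Longrightarrow> co k x = 0"
  by (simp add: co_def)

lemma co_0_index [simp]: "co 0 x = 0"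
  by (simp add: co_def)

lemma co_vec_of: "co k (vec_of f) = (if 1 \<le> k \<and> k \<le> N then f k else 0)"
  using inv_into_f_f[OF bij_betw_imp_inj_on[OF ax], of k] by (simp add: co_def vec_of_def)

lemma co_linear [simp]:
  "co k (x + y) = co k x + co k y" "co k (x - y) = co k x - co k y" "co k (- x) = - co k x"
  "co k (c *\<^sub>R x) = c * co k x" "co k 0 = 0" "co k (\<Sum>i\<in>I. f i) = (\<Sum>i\<in>I. co k (f i))"
  by (auto simp: co_def)

lemma co_ee: "co j (ee k) = (if j = k \<and> 1 \<le> k \<and> k \<le> N then 1 else 0)"
  using inj_on_eq_iff[OF bij_betw_imp_inj_on[OF ax], of j k] by (auto simp: co_def ee_def axis_def)

lemma co_ee_simps [simp]:
  "j \<noteq> k \<Longrightarrow> co j (ee k) = 0" "1 \<le> k \<Longrightarrow> k \<le> N \<Longrightarrow> co k (ee k) = 1"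
  by (auto simp: co_ee)

lemma ee_outside [simp]: "\<not> k \<le> N \<Longrightarrow> ee k = 0"
  by (simp add: ee_def)

lemma coordinate_eqI:
  assumes "\<And>k. 1 \<le> k \<Longrightarrow> k \<le> N \<Longrightarrow> co k x = co k y"
  shows "x = y"
  unfolding vec_eq_iff
proof
  fix i
  have "i \<in> ax ` {1..N}" unfolding bij_betw_imp_surj_on[OF ax] ..
  then obtain k where "k \<in> {1..N}" "i = ax k" by blast
  then show "x $ i = y $ i" using assms[of k] by (simp add: co_def)
qed

lemma index_cases:
  fixes k :: nat
  obtains "k = 0" | "k = 1" | "k = 2" | "k = 3" | "k = 4" | "k = 5" | "k = 6" | "k = 7" | "k = 8"
    | "k = 9" | "10 \<le> k"
proof -
  have "k = 0 \<or> k = 1 \<or> k = 2 \<or> k = 3 \<or> k = 4 \<or> k = 5 \<or> k = 6 \<or> k = 7 \<or> k = 8 \<or> k = 9 \<or> 10 \<le> k"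
    by presburger
  then show thesis using that by blast
qed

lemma coordinate_eqI':
  assumes "co 1 x = co 1 y" "co 2 x = co 2 y" "co 3 x = co 3 y" "co 4 x = co 4 y"
    "co 5 x = co 5 y" "co 6 x = co 6 y" "co 7 x = co 7 y" "co 8 x = co 8 y" "co 9 x = co 9 y"
    "\<And>k. 10 \<le> k \<Longrightarrow> k \<le> N \<Longrightarrow> co k x = co k y"
  shows "x = y"
proof (rule coordinate_eqI)
  fix k assume "1 \<le> k" "k \<le> N"
  then show "co k x = co k y"
    using assms by (cases k rule: index_cases) auto
qed

lemma expansion: "x = (\<Sum>k=1..N. co k x *\<^sub>R ee k)"
proof (rule coordinate_eqI)
  fix j assume j: "1 \<le> j" "j \<le> N"
  have "(\<Sum>k=1..N. co k x * co j (ee k)) = (\<Sum>k=1..N. if k = j then co j x else 0)"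
    by (rule sum.cong) (auto simp: co_ee)
  then show "co j x = co j (\<Sum>k=1..N. co k x *\<^sub>R ee k)"
    using j by simp
qed

lemma trace_coordinates:
  assumes Q: "inner_product Q" and B: "orthonormal_basis Q B" and T: "linear T"
  shows "(\<Sum>b\<in>B. Q (T b) b) = (\<Sum>k=1..N. co k (T (ee k)))"
proof -
  note lin = inner_product_linear[OF Q]
  have "(\<Sum>b\<in>B. Q (T b) b) = (\<Sum>b\<in>B. Q (T (\<Sum>k=1..N. co k b *\<^sub>R ee k)) b)"
    by (simp flip: expansion)
  also have "\<dots> = (\<Sum>b\<in>B. \<Sum>k=1..N. co k b * Q (T (ee k)) b)"
    by (simp add: linear_sum[OF T] linear_scale[OF T] linear_sum[OF lin(1)] linear_scale[OF lin(1)])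
  also have "\<dots> = (\<Sum>k=1..N. co k (\<Sum>b\<in>B. Q (T (ee k)) b *\<^sub>R b))"
    by (subst sum.swap) (simp add: mult.commute)
  also have "\<dots> = (\<Sum>k=1..N. co k (T (ee k)))"
    by (simp flip: orthonormal_basis_expansion[OF Q B])
  finally show ?thesis .
qed

text \<open>The Pluecker coordinates of the pair \<open>x, y\<close>, in which every alternating bilinear map is linear.\<close>

definition minor :: "nat \<Rightarrow> nat \<Rightarrow> real ^ 'n \<Rightarrow> real ^ 'n \<Rightarrow> real" where
  "minor i j x y = co i x * co j y - co j x * co i y"

text \<open>
  In dimension 9 the chain \<open>ee 9, ..., ee N\<close> consists of one vector, which would be a direct summand;
  the additional bracket \<open>[ee 2, ee 9] = ee 7\<close> ties it to the rest.
\<close>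

definition hook :: real where
  "hook = (if N = 9 then 1 else 0)"

definition br :: "real \<Rightarrow> real ^ 'n \<Rightarrow> real ^ 'n \<Rightarrow> real ^ 'n" where
  "br s x y = vec_of (\<lambda>k.
     if k = 3 then minor 1 2 x y
     else if k = 4 then minor 1 3 x y
     else if k = 5 then minor 1 4 x y + minor 2 3 x y
     else if k = 6 then minor 1 5 x y + minor 2 4 x y
     else if k = 7 then minor 1 6 x y + (1 - s) * minor 2 5 x y + s * minor 3 4 x y
       + hook * minor 2 9 x y
     else if k = 8 then minor 2 3 x y
     else if 10 \<le> k then minor 1 (k - 1) x y
     else 0)"

lemma co_br [simp]:
  "co 1 (br s x y) = 0"
  "co 2 (br s x y) = 0"
  "co 3 (br s x y) = minor 1 2 x y"
  "co 4 (br s x y) = minor 1 3 x y"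
  "co 5 (br s x y) = minor 1 4 x y + minor 2 3 x y"
  "co 6 (br s x y) = minor 1 5 x y + minor 2 4 x y"
  "co 7 (br s x y) = minor 1 6 x y + (1 - s) * minor 2 5 x y + s * minor 3 4 x y
     + hook * minor 2 9 x y"
  "co 8 (br s x y) = minor 2 3 x y"
  "co 9 (br s x y) = 0"
  "10 \<le> k \<Longrightarrow> k \<le> N \<Longrightarrow> co k (br s x y) = minor 1 (k - 1) x y"
  by (auto simp: br_def co_vec_of)

lemma bilinear_br: "bilinear (br s)"
  unfolding bilinear_def
  by (intro conjI allI linearI coordinate_eqI') (simp_all add: minor_def algebra_simps)

lemma br_self [simp]: "br s x x = 0"
  by (rule coordinate_eqI') (simp_all add: minor_def)

lemma br_antisym: "br s x y = - br s y x"
  by (rule alternating_antisym[OF bilinear_br br_self])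

text \<open>
  The Jacobi identity has content in two coordinates: in coordinate 6 it forces \<open>[ee 2, ee 4]\<close> to
  equal \<open>[ee 1, [ee 2, ee 3]]\<close>, and in coordinate 7 it says that the coefficients of
  \<open>[ee 2, ee 5]\<close> and \<open>[ee 3, ee 4]\<close> add up to that of \<open>[ee 1, [ee 2, ee 4]]\<close>, namely \<open>1\<close>.
\<close>

lemma lie_bracket_br: "lie_bracket (br s)"
proof -
  have "br s x (br s y z) + br s y (br s z x) + br s z (br s x y) = 0" for x y z
  proof (rule coordinate_eqI')
    fix k assume k: "10 \<le> k" "k \<le> N"
    \<comment> \<open>The coordinate before the tenth is the start of the chain, where all brackets vanish.\<close>
    then have "k = 10 \<or> 10 \<le> k - 1 \<and> k - 1 \<le> N" by auto
    then show "co k (br s x (br s y z) + br s y (br s z x) + br s z (br s x y)) = co k 0"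
      using k by (auto simp: minor_def algebra_simps)
  qed (simp_all add: minor_def algebra_simps)
  then show ?thesis
    using bilinear_br by (simp add: lie_bracket_def)
qed

lemma br_zero [simp]: "br s 0 y = 0" "br s x 0 = 0"
  using bilinear_lzero[OF bilinear_br] bilinear_rzero[OF bilinear_br] by auto

lemma br_ee [simp]:
  "br s (ee 1) (ee 2) = ee 3" "br s (ee 1) (ee 3) = ee 4" "br s (ee 1) (ee 4) = ee 5"
  "br s (ee 1) (ee 5) = ee 6" "br s (ee 1) (ee 6) = ee 7" "br s (ee 2) (ee 3) = ee 5 + ee 8"
  "br s (ee 3) (ee 4) = s *\<^sub>R ee 7" "br s (ee 2) (ee 9) = hook *\<^sub>R ee 7" "br s (ee 3) (ee 9) = 0"
  by (rule coordinate_eqI'; simp add: minor_def co_ee hook_def)+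

lemma br_ee_tail: "9 \<le> k \<Longrightarrow> br s (ee 1) (ee k) = ee (Suc k)"
  by (rule coordinate_eqI') (auto simp: minor_def co_ee)

lemma br_ee_9_10 [simp]: "br s (ee 9) (ee 10) = 0"
  by (rule coordinate_eqI') (auto simp: minor_def co_ee)

lemma ee_central [simp]: "br s (ee 7) y = 0" "br s (ee 8) y = 0" "10 \<le> N \<Longrightarrow> br s (ee N) y = 0"
  by (rule coordinate_eqI'; auto simp: minor_def co_ee)+

text \<open>
  The projection onto the span of \<open>ee 7\<close>, \<open>ee 8\<close> and the end of the chain, which is the centre.
  In dimension 9 the end of the chain is not central because of the hook, hence the condition.
\<close>

definition top_part :: "real ^ 'n \<Rightarrow> real ^ 'n" where
  "top_part x = co 7 x *\<^sub>R ee 7 + co 8 x *\<^sub>R ee 8 + (if 10 \<le> N then co N x else 0) *\<^sub>R ee N"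

lemma top_part_eqI:
  assumes "co 1 x = 0" "co 2 x = 0" "co 3 x = 0" "co 4 x = 0" "co 5 x = 0" "co 6 x = 0"
    and "co 9 x = 0" and "\<And>k. 10 \<le> k \<Longrightarrow> k < N \<Longrightarrow> co k x = 0"
  shows "x = top_part x"
  by (rule coordinate_eqI') (use assms in \<open>auto simp: top_part_def co_ee\<close>)

lemma central_imp_top_part:
  assumes c: "\<And>y. br s x y = 0"
  shows "x = top_part x"
proof (rule top_part_eqI)
  have e: "co k (br s x (ee 1)) = 0" "co k (br s x (ee 2)) = 0" for k
    by (simp_all add: c)
  show "co 1 x = 0" using e(2)[of 3] by (simp add: minor_def)
  show "co 2 x = 0" using e(1)[of 3] by (simp add: minor_def)
  show "co 3 x = 0" using e(1)[of 4] by (simp add: minor_def)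
  show "co 4 x = 0" using e(1)[of 5] by (simp add: minor_def)
  show "co 5 x = 0" using e(1)[of 6] by (simp add: minor_def)
  show "co 6 x = 0" using e(1)[of 7] by (simp add: minor_def)
  show tail: "co k x = 0" if "10 \<le> k" "k < N" for k
    using e(1)[of "Suc k"] that by (simp add: minor_def)
  consider "N = 8" | "N = 9" | "10 \<le> N" using dim by linarith
  then show "co 9 x = 0"
  proof cases
    case 1
    then have "\<not> 9 \<le> N" by simp
    then show ?thesis by simp
  next
    case 2
    then have "hook = 1" "9 \<le> N" unfolding hook_def by simp_all
    then show ?thesis
      using e(2)[of 7] \<open>co 1 x = 0\<close> \<open>co 3 x = 0\<close> \<open>co 4 x = 0\<close> \<open>co 5 x = 0\<close> \<open>co 6 x = 0\<close>
      by (simp add: minor_def co_ee)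
  next
    case 3
    then show ?thesis using e(1)[of 10] by (simp add: minor_def)
  qed
qed

section \<open>Positive grading and nilpotency\<close>

text \<open>
  The chain may start in any positive weight, except in dimension 9, where \<open>[ee 2, ee 9] = ee 7\<close>
  requires weight 5.
\<close>

definition wt :: "nat \<Rightarrow> nat" where
  "wt k = (if k \<le> 7 then k else if k = 8 then 5 else k - 4)"

lemma wt_pos: "0 < k \<Longrightarrow> 0 < wt k"
  by (simp add: wt_def)

text \<open>
  The bracket respects the weights coordinate by coordinate.  Both the grading and the descent of the
  lower central series are instances of this one vanishing statement.
\<close>

lemma br_weight:
  assumes z: "\<And>i j. wt i + wt j = wt k \<Longrightarrow> co i x * co j y = 0"
  shows "co k (br s x y) = 0"
proof -
  have m: "minor i j x y = 0" if "wt i + wt j = wt k" for i j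
  proof -
    have "co i x * co j y = 0" "co j x * co i y = 0"
      using z[of i j] z[of j i] that by (simp_all only: add.commute)
    then show ?thesis by (simp only: minor_def)
  qed
  show ?thesis
  proof (cases "k \<le> N")
    case True
    have "wt 1 + wt (k - 1) = wt k" if "10 \<le> k"
      using that by (auto simp: wt_def)
    then show ?thesis
      using True by (cases k rule: index_cases) (simp_all add: m wt_def)
  qed simp
qed

definition weight_space :: "nat \<Rightarrow> (real ^ 'n) set" where
  "weight_space i = {x. \<forall>k. wt k \<noteq> i \<longrightarrow> co k x = 0}"

lemma positively_graded_br: "positively_graded (br s)"
  unfolding positively_graded_def
proof (intro exI[of _ weight_space] conjI allI impI ballI)
  fix i j x y assume xy: "x \<in> weight_space i" "y \<in> weight_space j"
  have "co k (br s x y) = 0" if "wt k \<noteq> i + j" for k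
  proof (rule br_weight)
    fix i' j' assume "wt i' + wt j' = wt k"
    then have "wt i' \<noteq> i \<or> wt j' \<noteq> j" using that by auto
    then show "co i' x * co j' y = 0" using xy by (auto simp: weight_space_def)
  qed
  then show "br s x y \<in> weight_space (i + j)"
    by (simp add: weight_space_def)
next
  show "direct_sum_decomposition {1..} weight_space"
    unfolding direct_sum_decomposition_def
  proof (intro conjI ballI allI)
    fix i show "subspace (weight_space i)"
      by (auto simp: weight_space_def subspace_def)
  next
    fix x :: "real ^ 'n"
    define v where "v i = vec_of (\<lambda>k. if wt k = i then co k x else 0)" for i
    have co_v: "co k (v i) = (if wt k = i then co k x else 0)" for k i
      by (cases "k = 0") (auto simp: v_def co_vec_of)
    let ?P = "\<lambda>v. (\<forall>i\<in>{1..}. v i \<in> weight_space i) \<and> (\<forall>i. i \<notin> {1..} \<longrightarrow> v i = 0) \<and>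
        finite {i. v i \<noteq> 0} \<and> x = (\<Sum>i | v i \<noteq> 0. v i)"
    show "\<exists>!v. ?P v"
    proof (rule ex1I[of _ v])
      have "{i. v i \<noteq> 0} \<subseteq> wt ` {1..N}"
      proof
        fix i assume "i \<in> {i. v i \<noteq> 0}"
        then have "v i \<noteq> 0" by simp
        then obtain k where "1 \<le> k" "k \<le> N" "co k (v i) \<noteq> co k 0"
          using coordinate_eqI[of "v i" 0] by blast
        then show "i \<in> wt ` {1..N}" by (auto simp: co_v split: if_splits)
      qed
      then have fin: "finite {i. v i \<noteq> 0}"
        using finite_subset by blast
      have "co k x = (\<Sum>i | v i \<noteq> 0. if wt k = i then co k x else 0)" for k
        using fin co_v[of k "wt k"] by auto
      then have "x = (\<Sum>i | v i \<noteq> 0. v i)"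
        by (intro coordinate_eqI) (simp add: co_v)
      moreover have "v 0 = 0"
      proof (intro coordinate_eqI)
        fix k :: nat assume "1 \<le> k"
        then have "wt k \<noteq> 0" using wt_pos[of k] by simp
        then show "co k (v 0) = co k 0" by (simp add: co_v)
      qed
      ultimately show "?P v"
        using fin by (auto simp: weight_space_def co_v not_le)
    next
      fix v' assume v': "?P v'"
      have "co k (v' i) = co k (v i)" for k i
      proof -
        have "v' 0 = 0" using v' by simp
        then have ne: "co k (v' j) = 0" if "wt k \<noteq> j" for j
          using v' that by (cases "j = 0") (auto simp: weight_space_def)
        have "co k x = (\<Sum>i | v' i \<noteq> 0. co k (v' i))"
          using v' co_linear(6) by metis
        also have "\<dots> = (\<Sum>i | v' i \<noteq> 0. if wt k = i then co k (v' (wt k)) else 0)"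
          using ne by (intro sum.cong) auto
        also have "\<dots> = co k (v' (wt k))"
          using v' by auto
        finally show ?thesis
          using ne by (auto simp: co_v)
      qed
      then show "v' = v"
        by (intro ext coordinate_eqI)
    qed
  qed
qed

lemma lower_central_weight: "lower_central (br s) m \<subseteq> {x. \<forall>k. wt k \<le> m \<longrightarrow> co k x = 0}"
proof (induction m)
  case 0
  have "co k x = 0" if "wt k = 0" for k x
    using wt_pos[of k] that by (cases "k = 0") auto
  then show ?case by auto
next
  case (Suc m)
  have "co k (br s x y) = 0" if y: "y \<in> lower_central (br s) m" and k: "wt k \<le> Suc m" for x y k
  proof (rule br_weight)
    fix i j assume ij: "wt i + wt j = wt k"
    show "co i x * co j y = 0"
    proof (cases "i = 0")
      case False
      then have "wt j \<le> m" using wt_pos[of i] ij k by simp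
      then show ?thesis using Suc.IH y by auto
    qed simp
  qed
  then show ?case
    unfolding lower_central.simps
    by (intro span_minimal) (auto simp: subspace_def)
qed

lemma nilpotent_br: "nilpotent_bracket (br s)"
  unfolding nilpotent_bracket_def
proof (intro exI[of _ N] subset_antisym subsetI)
  fix x assume x: "x \<in> lower_central (br s) N"
  have "wt k \<le> N" if "k \<le> N" for k
    using that dim unfolding wt_def by auto
  then have "co k x = 0" if "k \<le> N" for k
    using lower_central_weight x that by blast
  then show "x \<in> {0}"
    using coordinate_eqI[of x 0] by auto
next
  fix x :: "real ^ 'n" assume "x \<in> {0}"
  moreover obtain m where "N = Suc m" using dim by (cases N) auto
  ultimately show "x \<in> lower_central (br s) N"
    by (auto intro: span_zero)
qed

section \<open>Indecomposability\<close>

lemma ideal_subspace: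
  assumes "lie_ideal (br s) I"
  shows "subspace I" "\<And>x y. y \<in> I \<Longrightarrow> br s x y \<in> I" "\<And>x y. x \<in> I \<Longrightarrow> br s x y \<in> I"
proof -
  show sub: "subspace I" and left: "\<And>x y. y \<in> I \<Longrightarrow> br s x y \<in> I"
    using assms by (auto simp: lie_ideal_def)
  show "br s x y \<in> I" if "x \<in> I" for x y
    using subspace_neg[OF sub left[OF that, of y]] br_antisym[of s x y] by simp
qed

text \<open>
  One of two complementary ideals contains a vector \<open>a\<close> with a nonzero coefficient at \<open>ee 1\<close>.  The
  other one, \<open>J\<close>, commutes with \<open>a\<close>, and bracketing with \<open>a\<close> shifts coordinates along both chains;
  so \<open>J\<close> is central.  But then all brackets lie in the first ideal, and they span a space that
  contains the centre.
\<close>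

lemma complement_of_regular_ideal_trivial:
  assumes I: "lie_ideal (br s) I" and J: "lie_ideal (br s) J" and IJ: "I \<inter> J = {0}"
    and sum: "{x + y |x y. x \<in> I \<and> y \<in> J} = UNIV" and a: "a \<in> I" "co 1 a \<noteq> 0"
  shows "J = {0}"
proof -
  note I = ideal_subspace[OF I] and J = ideal_subspace[OF J]
  have comm: "br s x y = 0" if "x \<in> I" "y \<in> J" for x y
    using I(3)[OF that(1)] J(2)[OF that(2)] IJ by blast
  have e7: "ee 7 \<in> I"
  proof -
    have "br s a (ee 6) = co 1 a *\<^sub>R ee 7"
      by (rule coordinate_eqI') (auto simp: minor_def co_ee)
    then have "(1 / co 1 a) *\<^sub>R (co 1 a *\<^sub>R ee 7) \<in> I"
      using I(3)[OF a(1), of "ee 6"] subspace_scale[OF I(1)] by metis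
    then show ?thesis using a(2) by simp
  qed
  have J_form: "y = top_part y" if y: "y \<in> J" for y
  proof (rule top_part_eqI)
    have b: "co k (br s a y) = 0" for k
      using comm[OF a(1) y] by simp
    \<comment> \<open>The coefficient of \<open>y\<close> at \<open>ee 1\<close> could be cancelled by a multiple of \<open>a\<close>; passing to the
      bracket \<open>[y, ee 2]\<close>, which also lies in \<open>J\<close>, excludes this.\<close>
    have "br s a (br s y (ee 2)) = 0"
      using comm[OF a(1) J(3)[OF y]] .
    then have "co 4 (br s a (br s y (ee 2))) = 0" by simp
    then show y1: "co 1 y = 0" using a(2) by (simp add: minor_def)
    show y2: "co 2 y = 0" using b[of 3] a(2) y1 by (simp add: minor_def)
    show y3: "co 3 y = 0" using b[of 4] a(2) y1 by (simp add: minor_def)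
    show y4: "co 4 y = 0" using b[of 5] a(2) y1 y2 y3 by (simp add: minor_def)
    show y5: "co 5 y = 0" using b[of 6] a(2) y1 y2 y4 by (simp add: minor_def)
    show "co k y = 0" if "10 \<le> k" "k < N" for k
      using b[of "Suc k"] a(2) y1 that by (simp add: minor_def)
    \<comment> \<open>The hook mixes coordinates 6 and 9 of \<open>[a, y]\<close>, so that coordinate 9 needs its own argument.\<close>
    have "br s (ee 2) y = (hook * co 9 y) *\<^sub>R ee 7"
      by (rule coordinate_eqI') (auto simp: minor_def co_ee y1 y2 y3 y4 y5)
    then have "(hook * co 9 y) *\<^sub>R ee 7 \<in> I \<inter> J"
      using J(2)[OF y, of "ee 2"] subspace_scale[OF I(1) e7] by simp
    then have "(hook * co 9 y) *\<^sub>R ee 7 = 0"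
      using IJ by blast
    then have "co 7 ((hook * co 9 y) *\<^sub>R ee 7) = 0" by (simp only: co_linear)
    then have hook_y: "hook * co 9 y = 0" by simp
    show "co 6 y = 0" using b[of 7] a(2) y1 y2 y3 y4 y5 hook_y by (auto simp: minor_def)
    consider "\<not> 9 \<le> N" | "N = 9" | "10 \<le> N" by linarith
    then show "co 9 y = 0"
    proof cases
      case 2
      then have "hook = 1" unfolding hook_def by simp
      then show ?thesis using hook_y by simp
    next
      case 3
      then show ?thesis using b[of 10] a(2) y1 by (simp add: minor_def)
    qed simp
  qed
  have brackets: "br s x y \<in> I" for x y
  proof -
    have "x \<in> {x + y |x y. x \<in> I \<and> y \<in> J}" using sum by simp
    then obtain i j where "x = i + j" "i \<in> I" "j \<in> J" by blast
    moreover have "br s j y = 0"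
    proof -
      have "br s j y = br s (top_part j) y"
        using J_form[OF \<open>j \<in> J\<close>] by simp
      also have "\<dots> = 0"
        by (simp add: top_part_def bilinear_ladd[OF bilinear_br] bilinear_lmul[OF bilinear_br])
      finally show ?thesis .
    qed
    ultimately show ?thesis
      using I(3)[of i y] by (simp add: bilinear_ladd[OF bilinear_br])
  qed
  have "y = 0" if y: "y \<in> J" for y
  proof -
    have "ee 8 = br s (ee 2) (ee 3) - br s (ee 1) (ee 4)" by simp
    then have e8: "ee 8 \<in> I"
      using brackets subspace_diff[OF I(1)] by metis
    have eN: "ee N \<in> I" if "10 \<le> N"
      using br_ee_tail[of "N - 1" s] brackets[of "ee 1" "ee (N - 1)"] that by simp
    have "top_part y \<in> I"
      unfolding top_part_def
      using e7 e8 eN by (auto intro!: subspace_add[OF I(1)] subspace_scale[OF I(1)])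
    then show ?thesis
      using J_form[OF y] y IJ by auto
  qed
  then show ?thesis
    using subspace_0[OF J(1)] by auto
qed

lemma indecomposable_br: "indecomposable (br s)"
  unfolding indecomposable_def
proof (intro notI, elim exE conjE)
  fix I J
  assume I: "lie_ideal (br s) I" and J: "lie_ideal (br s) J" and "I \<noteq> {0}" "J \<noteq> {0}"
    and IJ: "I \<inter> J = {0}" and sum: "{x + y |x y. x \<in> I \<and> y \<in> J} = UNIV"
  have "ee 1 \<in> {x + y |x y. x \<in> I \<and> y \<in> J}" using sum by simp
  then obtain i j where ij: "ee 1 = i + j" "i \<in> I" "j \<in> J" by blast
  then have "co 1 (i + j) = 1" using co_ee_simps(2)[of 1] by simp
  then have "co 1 i \<noteq> 0 \<or> co 1 j \<noteq> 0" by auto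
  then show False
  proof
    assume "co 1 i \<noteq> 0"
    then show False
      using complement_of_regular_ideal_trivial[OF I J IJ sum \<open>i \<in> I\<close>] \<open>J \<noteq> {0}\<close> by blast
  next
    assume "co 1 j \<noteq> 0"
    moreover have "{x + y |x y. x \<in> J \<and> y \<in> I} = {x + y |x y. x \<in> I \<and> y \<in> J}"
      by (auto; metis add.commute)
    ultimately show False
      using complement_of_regular_ideal_trivial[OF J I _ _ \<open>j \<in> J\<close>] IJ sum \<open>I \<noteq> {0}\<close> by blast
  qed
qed

section \<open>Derivations\<close>

text \<open>
  A derivation \<open>D\<close> is determined by its values on the generators \<open>ee 1, ee 2, ee 9\<close>.  Propagating
  them through the brackets yields the diagonal entries of \<open>D\<close> and shows that \<open>D\<close> is triangular
  where this is needed: the hyperplane \<open>co 1 x = 0\<close> is invariant, and so is a complement of \<open>ee 8\<close>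
  in the centre.
\<close>

definition center_part :: "real \<Rightarrow> (real ^ 'n) set" where
  "center_part s = {x. (\<forall>y. br s x y = 0) \<and> co 8 x = 0}"

lemma subspace_center_part: "subspace (center_part s)"
  by (auto simp: center_part_def subspace_def bilinear_ladd[OF bilinear_br]
      bilinear_lmul[OF bilinear_br])

context
  fixes s :: real and D :: "real ^ 'n \<Rightarrow> real ^ 'n"
  assumes D: "derivation (br s) D"
begin

lemma D_linear: "linear D"
  using D by (simp add: derivation_def)

lemma D_br: "D (br s x y) = br s (D x) y + br s x (D y)"
  using D by (simp add: derivation_def)

lemma D_central: "(\<And>y. br s x y = 0) \<Longrightarrow> br s (D x) y = 0"
  using D_br[of x y] linear_0[OF D_linear] by simp

lemma D_generated:
  "D (ee 3) = br s (D (ee 1)) (ee 2) + br s (ee 1) (D (ee 2))"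
  "D (ee 4) = br s (D (ee 1)) (ee 3) + br s (ee 1) (D (ee 3))"
  "D (ee 5) = br s (D (ee 1)) (ee 4) + br s (ee 1) (D (ee 4))"
  "D (ee 6) = br s (D (ee 1)) (ee 5) + br s (ee 1) (D (ee 5))"
  "D (ee 7) = br s (D (ee 1)) (ee 6) + br s (ee 1) (D (ee 6))"
  "D (ee 8) = br s (D (ee 2)) (ee 3) + br s (ee 2) (D (ee 3)) - D (ee 5)"
  "9 \<le> k \<Longrightarrow> D (ee (Suc k)) = br s (D (ee 1)) (ee k) + br s (ee 1) (D (ee k))"
  using D_br[of "ee 1" "ee 2"] D_br[of "ee 1" "ee 3"] D_br[of "ee 1" "ee 4"]
    D_br[of "ee 1" "ee 5"] D_br[of "ee 1" "ee 6"] D_br[of "ee 2" "ee 3"] D_br[of "ee 1" "ee k"]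
  by (simp_all add: linear_add[OF D_linear] br_ee_tail algebra_simps)

lemma co_D3:
  "co 1 (D (ee 3)) = 0" "co 2 (D (ee 3)) = 0"
  "co 3 (D (ee 3)) = co 1 (D (ee 1)) + co 2 (D (ee 2))"
  by (simp_all add: D_generated(1) minor_def)

lemma co_D4:
  "co 1 (D (ee 4)) = 0" "co 2 (D (ee 4)) = 0" "co 3 (D (ee 4)) = 0"
  "co 4 (D (ee 4)) = 2 * co 1 (D (ee 1)) + co 2 (D (ee 2))"
  by (simp_all add: D_generated(2) minor_def co_D3)

lemma co_D5:
  "co 1 (D (ee 5)) = 0" "co 2 (D (ee 5)) = 0" "co 3 (D (ee 5)) = 0" "co 4 (D (ee 5)) = 0"
  "co 5 (D (ee 5)) = 3 * co 1 (D (ee 1)) + co 2 (D (ee 2))" "co 8 (D (ee 5)) = 0"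
  by (simp_all add: D_generated(3) minor_def co_D4)

lemma co_D6:
  "co 1 (D (ee 6)) = 0" "co 6 (D (ee 6)) = 4 * co 1 (D (ee 1)) + co 2 (D (ee 2))"
  by (simp_all add: D_generated(4) minor_def co_D5)

lemma co_D7:
  "co 1 (D (ee 7)) = 0" "co 7 (D (ee 7)) = 5 * co 1 (D (ee 1)) + co 2 (D (ee 2))"
  "co 8 (D (ee 7)) = 0"
  by (simp_all add: D_generated(5) minor_def co_D6)

lemma D_ee8_central: "br s (D (ee 8)) y = 0"
  by (rule D_central) simp

text \<open>
  The relation between the eigenvalues on the two generators comes from \<open>ee 8\<close> being central:
  \<open>[ee 1, [ee 1, [ee 1, ee 2]]]\<close> and \<open>[ee 2, [ee 1, ee 2]]\<close> agree modulo the centre.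
\<close>

lemma D_ee2: "co 1 (D (ee 2)) = 0" "co 2 (D (ee 2)) = 2 * co 1 (D (ee 1))"
proof -
  have z: "co k (D (ee 8)) = co k (top_part (D (ee 8)))" for k
    using central_imp_top_part[OF D_ee8_central] by simp
  show "co 1 (D (ee 2)) = 0"
    using z[of 4] by (simp add: D_generated(6) minor_def co_D5 co_D3 top_part_def co_ee)
  then show "co 2 (D (ee 2)) = 2 * co 1 (D (ee 1))"
    using z[of 5] by (simp add: D_generated(6) minor_def co_D5 co_D3 top_part_def co_ee)
qed

lemma co_D8: "co 1 (D (ee 8)) = 0" "co 8 (D (ee 8)) = 5 * co 1 (D (ee 1))"
  by (simp_all add: D_generated(6) minor_def co_D5 co_D3 D_ee2)

text \<open>The vanishing of \<open>[ee 3, ee 9]\<close> keeps \<open>ee 1\<close> out of the image of \<open>ee 9\<close>.\<close>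

lemma co_1_D9: "co 1 (D (ee 9)) = 0"
proof -
  have "br s (D (ee 3)) (ee 9) + br s (ee 3) (D (ee 9)) = 0"
    using D_br[of "ee 3" "ee 9"] linear_0[OF D_linear] by simp
  then have "co 4 (br s (D (ee 3)) (ee 9) + br s (ee 3) (D (ee 9))) = 0" by simp
  then show ?thesis by (simp add: minor_def)
qed

lemma co_D_tail:
  assumes "10 \<le> k"
  shows "co 1 (D (ee k)) = 0" "co 8 (D (ee k)) = 0"
  using D_generated(7)[of "k - 1"] assms by (simp_all add: minor_def)

lemma D_tail_eigenvalue:
  assumes "9 \<le> k" "k \<le> N"
  shows "co k (D (ee k)) = co 9 (D (ee 9)) + (real k - 9) * co 1 (D (ee 1))"
  using assms
proof (induction k rule: dec_induct)
  case (step k)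
  then show ?case
    by (simp add: D_generated(7) minor_def algebra_simps)
qed simp

text \<open>
  Without the hook the eigenvalue on \<open>ee 9\<close> is arbitrary.  In dimension 9 the relation
  \<open>[ee 2, ee 9] = ee 7\<close> fixes it as \<open>(7 - 2) \<delta>\<close>, where \<open>[ee 1, ee 9] = 0\<close> is needed to exclude an
  admixture of \<open>ee 5\<close>, which \<open>ee 2\<close> also maps to \<open>ee 7\<close>.
\<close>

lemma D_tail_eigenvalue_hook:
  assumes "N = 9"
  shows "co 9 (D (ee 9)) = 5 * co 1 (D (ee 1))"
proof -
  have N: "9 \<le> N" "\<not> 10 \<le> N" and hook: "hook = 1"
    using assms unfolding hook_def by simp_all
  have "D (br s (ee 1) (ee 9)) = 0"
    using br_ee_tail[of 9 s] N linear_0[OF D_linear] by simp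
  then have "co 6 (br s (D (ee 1)) (ee 9) + br s (ee 1) (D (ee 9))) = 0"
    by (simp only: D_br[symmetric] co_linear)
  then have "co 5 (D (ee 9)) = 0" by (simp add: minor_def)
  moreover have "co 7 (D (ee 7)) = co 7 (br s (D (ee 2)) (ee 9) + br s (ee 2) (D (ee 9)))"
    using D_br[of "ee 2" "ee 9"] hook by simp
  ultimately show ?thesis
    using N(1) hook by (simp add: co_D7 minor_def D_ee2 co_1_D9)
qed

lemma D_eigenvalues:
  "co 2 (D (ee 2)) = 2 * co 1 (D (ee 1))" "co 3 (D (ee 3)) = 3 * co 1 (D (ee 1))"
  "co 4 (D (ee 4)) = 4 * co 1 (D (ee 1))" "co 5 (D (ee 5)) = 5 * co 1 (D (ee 1))"
  "co 6 (D (ee 6)) = 6 * co 1 (D (ee 1))" "co 7 (D (ee 7)) = 7 * co 1 (D (ee 1))"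
  "co 8 (D (ee 8)) = 5 * co 1 (D (ee 1))"
  by (simp_all add: co_D3 co_D4 co_D5 co_D6 co_D7 co_D8 D_ee2)

lemma co_1_D: "co 1 x = 0 \<Longrightarrow> co 1 (D x) = 0"
proof -
  assume x: "co 1 x = 0"
  have "co 1 (D x) = (\<Sum>k=1..N. co k x * co 1 (D (ee k)))"
    by (subst expansion[of x])
      (simp only: linear_sum[OF D_linear] linear_scale[OF D_linear] co_linear)
  also have "\<dots> = 0"
  proof (rule sum.neutral, rule ballI)
    fix k show "co k x * co 1 (D (ee k)) = 0"
      by (cases k rule: index_cases)
        (simp_all add: x co_D3 co_D4 co_D5 co_D6 co_D7 co_D8 D_ee2 co_1_D9 co_D_tail)
  qed
  finally show ?thesis .
qed

lemma center_part_D: "x \<in> center_part s \<Longrightarrow> D x \<in> center_part s"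
proof -
  assume "x \<in> center_part s"
  then have c: "\<And>y. br s x y = 0" and x8: "co 8 x = 0" by (auto simp: center_part_def)
  have "co 8 (D (top_part x)) = 0"
    by (simp add: top_part_def x8 linear_add[OF D_linear] linear_scale[OF D_linear] co_D7 co_D_tail)
  then show ?thesis
    using D_central[OF c] central_imp_top_part[OF c] by (simp add: center_part_def)
qed

lemma D_ee8: "D (ee 8) - (5 * co 1 (D (ee 1))) *\<^sub>R ee 8 \<in> center_part s"
  by (simp add: center_part_def D_ee8_central co_D8 bilinear_lsub[OF bilinear_br]
      bilinear_lmul[OF bilinear_br])

end

section \<open>Absence of soliton inner products\<close>

text \<open>
  The eigenvalues of the diagonal derivation \<open>W\<close> that is tested against the Ricci endomorphism.
  The chain carries a free shift, chosen to make its eigenvalues sum to zero.  The unknown common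
  eigenvalue of a derivation on the chain then drops out of the trace.  In dimension 9 the hook leaves
  no freedom and the eigenvalue is 5.
\<close>

definition om :: "nat \<Rightarrow> real" where
  "om k = (if k \<le> 7 then real k else if k = 8 \<or> N = 9 then 5 else real k - (real N + 9) / 2)"

definition W :: "real ^ 'n \<Rightarrow> real ^ 'n" where
  "W x = vec_of (\<lambda>k. om k * co k x)"

lemma co_W: "co k (W x) = om k * co k x"
  by (cases "k = 0") (auto simp: W_def co_vec_of)

lemma W_ee: "W (ee k) = om k *\<^sub>R ee k"
  by (rule coordinate_eqI) (simp add: co_W co_ee)

lemma om_simps:
  "om 1 = 1" "om 2 = 2" "om 3 = 3" "om 4 = 4" "om 5 = 5" "om 6 = 6" "om 7 = 7" "om 8 = 5"
  by (simp_all add: om_def)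

lemma om_tail: "9 \<le> k \<Longrightarrow> N \<noteq> 9 \<Longrightarrow> om k = real k - (real N + 9) / 2"
  unfolding om_def by auto

lemma derivation_W: "derivation (br s) W"
  unfolding derivation_def
proof (intro conjI allI)
  show "linear W"
    by (intro linearI coordinate_eqI) (simp_all add: co_W algebra_simps)
next
  fix x y
  have hook_om: "hook = 0 \<or> om 9 = 5"
    unfolding hook_def om_def by auto
  show "W (br s x y) = br s (W x) y + br s x (W y)"
  proof (rule coordinate_eqI')
    fix k assume k: "10 \<le> k" "k \<le> N"
    then have "om k = 1 + om (k - 1)"
      using om_tail[of k] om_tail[of "k - 1"] by auto
    then show "co k (W (br s x y)) = co k (br s (W x) y + br s x (W y))"
      using k by (simp add: co_W minor_def om_simps algebra_simps)
  next
    show "co 7 (W (br s x y)) = co 7 (br s (W x) y + br s x (W y))"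
      using hook_om by (elim disjE) (simp_all add: co_W minor_def om_simps algebra_simps)
  qed (simp_all add: co_W minor_def om_simps algebra_simps)
qed

lemma sum_om_tail:
  assumes "N \<noteq> 9"
  shows "(\<Sum>k=9..N. om k) = 0"
proof -
  have "(\<Sum>k=9..N. om k) = (\<Sum>k=9..N. om (N + 9 - k))"
    by (rule sum.atLeastAtMost_rev)
  also have "\<dots> = (\<Sum>k=9..N. - om k)"
    using assms by (intro sum.cong) (auto simp: om_tail field_simps)
  finally show ?thesis by (simp add: sum_negf)
qed

lemma sum_split_8: "(\<Sum>k=1..N. f k) =
    f 1 + f 2 + f 3 + f 4 + f 5 + f 6 + f 7 + f 8 + (\<Sum>k=9..N. f k)" for f :: "nat \<Rightarrow> real"
proof -
  obtain p where "N = 8 + p" using dim le_Suc_ex by blast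
  then have "(\<Sum>k=1..N. f k) = (\<Sum>k=1..8. f k) + (\<Sum>k=9..N. f k)"
    using sum.ub_add_nat[of 1 8 f p] by simp
  also have "(\<Sum>k=1..8. f k) = f 1 + f 2 + f 3 + f 4 + f 5 + f 6 + f 7 + f 8"
    by (simp add: eval_nat_numeral One_nat_def)
  finally show ?thesis .
qed

text \<open>
  These are the traces of \<open>W\<close> and of \<open>D \<circ> W\<close>.  The constants are
  \<open>1 + 2 + ... + 7 + 5 = 33\<close> and \<open>1 + 4 + ... + 49 + 25 = 165\<close>, increased by 5 and 25 in dimension 9.
  Otherwise the chain contributes nothing to the first and a sum of squares to the second.
\<close>

lemma trace_inequality:
  assumes D: "derivation (br s) D"
  obtains \<sigma> \<tau> where "0 < \<sigma>" "5 * \<sigma> \<le> \<tau>" "(\<Sum>k=1..N. om k) = \<sigma>"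
    "(\<Sum>k=1..N. om k * co k (D (ee k))) = \<tau> * co 1 (D (ee 1))"
proof (cases "N = 9")
  case True
  then have tail: "(\<Sum>k=9..N. f k) = f 9" for f :: "nat \<Rightarrow> real" by simp
  have om9: "om 9 = 5" using True unfolding om_def by simp
  have "(\<Sum>k=1..N. om k) = 38"
    by (simp add: sum_split_8 tail om_simps om9)
  moreover have "(\<Sum>k=1..N. om k * co k (D (ee k))) = 190 * co 1 (D (ee 1))"
    by (simp add: sum_split_8 tail om_simps om9 D_eigenvalues[OF D] D_tail_eigenvalue_hook[OF D True])
  ultimately show ?thesis
    using that[of 38 190] by simp
next
  case False
  define V where "V = (\<Sum>k=9..N. om k * om k)"
  have "(\<Sum>k=9..N. om k * co k (D (ee k)))
      = (\<Sum>k=9..N. om k * om k * co 1 (D (ee 1))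
          + om k * (co 9 (D (ee 9)) + ((real N + 9) / 2 - 9) * co 1 (D (ee 1))))"
  proof (rule sum.cong[OF refl])
    fix k assume k: "k \<in> {9..N}"
    then have "real k - 9 = om k + ((real N + 9) / 2 - 9)"
      using False by (simp add: om_tail field_simps)
    then have "co k (D (ee k)) = co 9 (D (ee 9)) + (om k + ((real N + 9) / 2 - 9)) * co 1 (D (ee 1))"
      using D_tail_eigenvalue[OF D, of k] k by simp
    then show "om k * co k (D (ee k)) = om k * om k * co 1 (D (ee 1))
          + om k * (co 9 (D (ee 9)) + ((real N + 9) / 2 - 9) * co 1 (D (ee 1)))"
      by (simp only:) (simp add: algebra_simps)
  qed
  also have "\<dots> = V * co 1 (D (ee 1))"
    by (simp only: sum.distrib V_def sum_om_tail[OF False] mult_zero_left add_0_right flip: sum_distrib_right)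
  finally have tail: "(\<Sum>k=9..N. om k * co k (D (ee k))) = V * co 1 (D (ee 1))" .
  have "0 \<le> V" by (simp add: V_def sum_nonneg)
  then show ?thesis
    using that[of 33 "165 + V"] tail sum_om_tail[OF False]
    by (simp add: sum_split_8 om_simps D_eigenvalues[OF D] algebra_simps)
qed

theorem not_soliton_br: "\<not> soliton (br s)"
proof
  assume "soliton (br s)"
  then obtain Q R \<beta> B where Q: "inner_product Q" and B: "orthonormal_basis Q B"
    and ric: "\<And>x y. Q (R x) y = ricci_form (br s) Q B x y"
    and der: "derivation (br s) (\<lambda>x. R x - \<beta> *\<^sub>R x)"
    by (auto simp: soliton_def soliton_inner_product_def ricci_endomorphism_def)
  define D where "D = (\<lambda>x. R x - \<beta> *\<^sub>R x)"
  have D: "derivation (br s) D" using der by (simp add: D_def)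
  note lin = inner_product_linear[OF Q] and D_lin = D_linear[OF D]
  define \<delta> where "\<delta> = co 1 (D (ee 1))"
  have ric_D: "ricci_form (br s) Q B x y = Q (D x) y + \<beta> * Q x y" for x y
  proof -
    have "R x = D x + \<beta> *\<^sub>R x" by (simp add: D_def)
    then show ?thesis
      unfolding ric[symmetric] by (simp only: linear_add[OF lin(1)] linear_scale[OF lin(1)] real_scaleR_def)
  qed

  obtain \<sigma> \<tau> where \<sigma>\<tau>: "0 < \<sigma>" "5 * \<sigma> \<le> \<tau>" and sum_om: "(\<Sum>k=1..N. om k) = \<sigma>"
    and sum_om_D: "(\<Sum>k=1..N. om k * co k (D (ee k))) = \<tau> * \<delta>"
    using trace_inequality[OF D] unfolding \<delta>_def by blast
  have linW: "linear W" using derivation_W by (auto simp: derivation_def)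
  have "0 = (\<Sum>b\<in>B. ricci_form (br s) Q B (W b) b)"
    using ricci_form_derivation_trace[OF bilinear_br br_self Q B derivation_W] by simp
  also have "\<dots> = (\<Sum>b\<in>B. Q (D (W b)) b) + \<beta> * (\<Sum>b\<in>B. Q (W b) b)"
    by (simp add: ric_D sum.distrib sum_distrib_left)
  also have "(\<Sum>b\<in>B. Q (D (W b)) b) = \<tau> * \<delta>"
    using trace_coordinates[OF Q B linear_compose[OF linW D_lin]]
    by (simp add: W_ee linear_scale[OF D_lin] sum_om_D)
  also have "(\<Sum>b\<in>B. Q (W b) b) = (\<Sum>k=1..N. om k)"
    unfolding trace_coordinates[OF Q B linW] by (intro sum.cong) (auto simp: W_ee)
  finally have trace: "\<tau> * \<delta> + \<beta> * \<sigma> = 0"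
    by (simp add: sum_om)

  \<comment> \<open>The direction of \<open>ee 8\<close> within the centre has positive Ricci curvature.\<close>
  have central: "0 < 5 * \<delta> + \<beta>"
  proof -
    obtain f where f: "ee 8 - f \<in> center_part s" "\<And>y. y \<in> center_part s \<Longrightarrow> Q f y = 0"
      "Q (D f) f = 5 * \<delta> * Q f f"
      using orthogonal_representative[OF Q D_lin subspace_center_part[of s] center_part_D[OF D]
          D_ee8[OF D]] unfolding \<delta>_def by blast
    have "br s (ee 8 - f) y = 0" for y
      using f(1) by (simp add: center_part_def)
    then have f_central: "br s f y = 0" for y
      by (simp add: bilinear_lsub[OF bilinear_br])
    have "co 8 (ee 8 - f) = 0" using f(1) by (simp add: center_part_def)
    then have "co 8 f = 1" by simp
    then have "f \<noteq> 0" by auto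
    then have pos: "0 < Q f f" by (rule inner_product_pos[OF Q])
    have "Q (ee 8) f = Q f f"
      using f(2)[OF f(1)] inner_product_sym[OF Q, of f "ee 8"] by (simp add: linear_diff[OF lin(2)])
    moreover have "Q (ee 8) f = Q (br s (ee 2) (ee 3)) f - Q (br s (ee 1) (ee 4)) f"
      by (simp add: linear_add[OF lin(1)])
    ultimately have "Q (br s (ee 2) (ee 3)) f \<noteq> 0 \<or> Q (br s (ee 1) (ee 4)) f \<noteq> 0"
      using pos by auto
    then have "0 < ricci_form (br s) Q B f f"
      using ricci_form_central_pos[OF bilinear_br Q B f_central] by blast
    then have "0 < (5 * \<delta> + \<beta>) * Q f f"
      by (simp add: ric_D f(3) algebra_simps)
    then show ?thesis
      using pos by (simp add: zero_less_mult_iff)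
  qed

  \<comment> \<open>The direction orthogonal to all \<open>ee k\<close> with \<open>k \<ge> 2\<close> has nonpositive Ricci curvature.\<close>
  have generator: "\<delta> + \<beta> \<le> 0"
  proof -
    let ?Y = "{x. co 1 x = 0}"
    have sub: "subspace ?Y" by (auto simp: subspace_def)
    have inv: "D x \<in> ?Y" if "x \<in> ?Y" for x
      using co_1_D[OF D] that by simp
    have ee1: "D (ee 1) - \<delta> *\<^sub>R ee 1 \<in> ?Y"
      by (simp add: \<delta>_def)
    obtain f where f: "ee 1 - f \<in> ?Y" "\<And>y. y \<in> ?Y \<Longrightarrow> Q f y = 0"
      "Q (D f) f = \<delta> * Q f f"
      using orthogonal_representative[OF Q D_lin sub inv ee1] by blast
    have "co 1 f = 1" using f(1) by simp
    then have "f \<noteq> 0" by auto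
    then have pos: "0 < Q f f" by (rule inner_product_pos[OF Q])
    have "Q (br s x y) f = 0" for x y
      using f(2)[of "br s x y"] inner_product_sym[OF Q] by simp
    then have "ricci_form (br s) Q B f f \<le> 0"
      by (rule ricci_form_orthogonal_nonpos[OF Q])
    then have "(\<delta> + \<beta>) * Q f f \<le> 0"
      by (simp add: ric_D f(3) algebra_simps)
    then show ?thesis
      using pos by (simp add: mult_le_0_iff)
  qed

  have "0 < \<delta>" using central generator by simp
  then have "5 * \<sigma> * \<delta> \<le> \<tau> * \<delta>"
    using \<sigma>\<tau>(2) by (intro mult_right_mono) auto
  then have "(5 * \<delta> + \<beta>) * \<sigma> \<le> 0"
    using trace by (simp add: algebra_simps)
  then show False
    using central \<sigma>\<tau>(1) by (simp add: mult_le_0_iff)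
qed

section \<open>Distinct parameters give non-isomorphic algebras\<close>

context
  fixes s t :: real and g :: "real ^ 'n \<Rightarrow> real ^ 'n"
  assumes lin: "linear g" and bij: "bij g" and hom: "\<And>x y. g (br s x y) = br t (g x) (g y)"
begin

lemma g_generated:
  "g (ee 3) = br t (g (ee 1)) (g (ee 2))"
  "g (ee 4) = br t (g (ee 1)) (g (ee 3))"
  "g (ee 5) = br t (g (ee 1)) (g (ee 4))"
  "g (ee 6) = br t (g (ee 1)) (g (ee 5))"
  "g (ee 7) = br t (g (ee 1)) (g (ee 6))"
  "g (ee 8) = br t (g (ee 2)) (g (ee 3)) - g (ee 5)"
  "9 \<le> k \<Longrightarrow> g (ee (Suc k)) = br t (g (ee 1)) (g (ee k))"
  by (simp_all add: hom[symmetric] linear_add[OF lin] br_ee_tail)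

lemma g_central: "(\<And>y. br s x y = 0) \<Longrightarrow> br t (g x) y = 0"
  using hom[of x "inv g y"] bij linear_0[OF lin] by (simp add: bij_is_surj surj_f_inv_f)

lemma g_central_coordinates:
  assumes "\<And>y. br s x y = 0" and "1 \<le> k" "k \<le> 6"
  shows "co k (g x) = 0"
proof -
  have "co k (g x) = co k (top_part (g x))"
    using central_imp_top_part[OF g_central[OF assms(1)]] by simp
  then show ?thesis
    using assms(2,3) by (simp add: top_part_def co_ee)
qed

lemma g_derived: "k \<noteq> 1 \<Longrightarrow> k \<noteq> 2 \<Longrightarrow> k \<noteq> 9 \<Longrightarrow> co 1 (g (ee k)) = 0 \<and> co 2 (g (ee k)) = 0"
proof (cases k rule: index_cases)
  case 11
  then show ?thesis using g_generated(7)[of "k - 1"] by simp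
next
  case 1
  then show ?thesis by (simp add: ee_def linear_0[OF lin])
qed (simp_all add: g_generated)

text \<open>
  Coordinates 1 and 2 of \<open>g x\<close> come from the images of the generators \<open>ee 1, ee 2, ee 9\<close> alone, since
  \<open>g\<close> maps the other basis vectors to sums of brackets; and \<open>g\<close> is onto.
\<close>

lemma generators_independent:
  "minor 1 2 (g (ee 1)) (g (ee 2)) \<noteq> 0 \<or> minor 1 2 (g (ee 1)) (g (ee 9)) \<noteq> 0
    \<or> minor 1 2 (g (ee 2)) (g (ee 9)) \<noteq> 0"
proof (rule ccontr)
  assume "\<not> ?thesis"
  then have m: "minor 1 2 (g (ee 1)) (g (ee 2)) = 0" "minor 1 2 (g (ee 1)) (g (ee 9)) = 0"
    "minor 1 2 (g (ee 2)) (g (ee 9)) = 0" by auto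
  have co_g: "co j (g x) = co 1 x * co j (g (ee 1)) + co 2 x * co j (g (ee 2)) + co 9 x * co j (g (ee 9))"
    if "j = 1 \<or> j = 2" for j x
  proof -
    have "co j (g x) = (\<Sum>k=1..N. co k x * co j (g (ee k)))"
      by (subst expansion[of x]) (simp only: linear_sum[OF lin] linear_scale[OF lin] co_linear)
    also have "\<dots> = (\<Sum>k\<in>{1, 2, 9}. co k x * co j (g (ee k)))"
      using that g_derived dim by (intro sum.mono_neutral_cong) auto
    finally show ?thesis by simp
  qed
  obtain x where x: "g x = ee 1" using bij by (metis bij_pointE)
  obtain y where y: "g y = ee 2" using bij by (metis bij_pointE)
  have "minor 1 2 (g x) (g y) = 
      (co 1 x * co 2 y - co 2 x * co 1 y) * minor 1 2 (g (ee 1)) (g (ee 2))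
    + (co 1 x * co 9 y - co 9 x * co 1 y) * minor 1 2 (g (ee 1)) (g (ee 9))
    + (co 2 x * co 9 y - co 9 x * co 2 y) * minor 1 2 (g (ee 2)) (g (ee 9))"
    by (simp only: minor_def co_g[OF disjI1[OF refl], of x] co_g[OF disjI2[OF refl], of x]
        co_g[OF disjI1[OF refl], of y] co_g[OF disjI2[OF refl], of y]) (simp add: algebra_simps)
  then have "minor 1 2 (g x) (g y) = 0" by (simp add: m)
  then show False by (simp add: x y minor_def)
qed

text \<open>
  It remains to exclude that \<open>ee 9\<close> takes over the part of \<open>ee 1\<close> or \<open>ee 2\<close>.  The bracket
  \<open>[ee 2, ee 9]\<close> is central and \<open>[ee 9, [ee 1, ee 9]]\<close> vanishes, whereas neither would be true of the
  images if the corresponding minor were nonzero.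
\<close>

lemma minor_g12: "minor 1 2 (g (ee 1)) (g (ee 2)) \<noteq> 0"
proof
  assume m12: "minor 1 2 (g (ee 1)) (g (ee 2)) = 0"
  have "br t (g (ee 2)) (g (ee 9)) = hook *\<^sub>R g (ee 7)"
    by (simp add: hom[symmetric] linear_scale[OF lin])
  then have "co 3 (br t (g (ee 2)) (g (ee 9))) = hook * co 3 (g (ee 7))" by simp
  then have m29: "minor 1 2 (g (ee 2)) (g (ee 9)) = 0"
    by (simp add: g_central_coordinates)
  then have m19: "minor 1 2 (g (ee 1)) (g (ee 9)) \<noteq> 0"
    using generators_independent m12 by blast
  have "br t (g (ee 9)) (g (ee 10)) = 0"
    by (simp add: hom[symmetric] linear_0[OF lin])
  then have z: "co k (br t (g (ee 9)) (g (ee 10))) = 0" for k by simp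
  have e10: "g (ee 10) = br t (g (ee 1)) (g (ee 9))"
    using g_generated(7)[of 9] by simp
  have "co 1 (g (ee 9)) = 0" "co 2 (g (ee 9)) = 0"
    using z[of 4] z[of 8] m19 by (simp_all add: e10 minor_def[of _ _ "g (ee 9)"])
  then show False using m19 by (simp add: minor_def)
qed

text \<open>
  Leading coefficients of the images of \<open>ee 3, ..., ee 7\<close> are computed from those of \<open>ee 1\<close> and
  \<open>ee 2\<close>.  Centrality of \<open>ee 8\<close> makes them powers of a single scalar, and comparing
  \<open>[ee 3, ee 4] = s ee 7\<close> with its image leaves only the parameters.
\<close>

lemma parameters_equal: "s = t"
proof -
  define p q where "p = g (ee 1)" and "q = g (ee 2)"
  define \<Delta> where "\<Delta> = minor 1 2 p q"
  have \<Delta>: "\<Delta> \<noteq> 0" using minor_g12 by (simp add: \<Delta>_def p_def q_def)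
  note gen = g_generated[folded p_def q_def]
  have e3: "co 1 (g (ee 3)) = 0" "co 2 (g (ee 3)) = 0" "co 3 (g (ee 3)) = \<Delta>"
    by (simp_all add: gen(1) \<Delta>_def)
  have e4: "co 1 (g (ee 4)) = 0" "co 2 (g (ee 4)) = 0" "co 3 (g (ee 4)) = 0"
    "co 4 (g (ee 4)) = co 1 p * \<Delta>"
    using e3 by (simp_all add: gen(2) minor_def)
  have e5: "co 1 (g (ee 5)) = 0" "co 2 (g (ee 5)) = 0" "co 3 (g (ee 5)) = 0"
    "co 4 (g (ee 5)) = 0" "co 5 (g (ee 5)) = co 1 p ^ 2 * \<Delta>"
    using e4 by (simp_all add: gen(3) minor_def power2_eq_square)
  have e6: "co 1 (g (ee 6)) = 0" "co 2 (g (ee 6)) = 0" "co 3 (g (ee 6)) = 0"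
    "co 4 (g (ee 6)) = 0" "co 5 (g (ee 6)) = 0" "co 9 (g (ee 6)) = 0"
    "co 6 (g (ee 6)) = co 1 p ^ 3 * \<Delta>"
    using e5 by (simp_all add: gen(4) minor_def power2_eq_square power3_eq_cube)
  have e7: "co 7 (g (ee 7)) = co 1 p ^ 4 * \<Delta>"
    using e6 by (simp add: gen(5) minor_def power3_eq_cube power4_eq_xxxx)
  have "co 4 (g (ee 8)) = 0" "co 5 (g (ee 8)) = 0"
    by (auto intro: g_central_coordinates)
  then have "co 1 q * \<Delta> = 0" and "co 1 q * co 4 (g (ee 3)) + co 2 q * \<Delta> = co 1 p ^ 2 * \<Delta>"
    using e3 e5 by (simp_all add: gen(6) minor_def)
  then have q: "co 1 q = 0" "co 2 q = co 1 p ^ 2"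
    using \<Delta> by auto
  then have \<Delta>_eq: "\<Delta> = co 1 p ^ 3"
    by (simp add: \<Delta>_def minor_def power2_eq_square power3_eq_cube)
  have "br t (g (ee 3)) (g (ee 4)) = s *\<^sub>R g (ee 7)"
    by (simp add: hom[symmetric] linear_scale[OF lin])
  then have "co 7 (br t (g (ee 3)) (g (ee 4))) = s * co 7 (g (ee 7))"
    by simp
  then have "t * (\<Delta> * (co 1 p * \<Delta>)) = s * (co 1 p ^ 4 * \<Delta>)"
    using e3 e4 by (simp add: e7 minor_def)
  then have "(t - s) * co 1 p ^ 7 = 0"
    unfolding \<Delta>_eq by algebra
  moreover have "co 1 p \<noteq> 0" using \<Delta> \<Delta>_eq by auto
  ultimately show ?thesis by simp
qed

end

lemma not_isomorphic_br: "s \<noteq> t \<Longrightarrow> \<not> lie_isomorphic (br s) (br t)"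
  unfolding lie_isomorphic_def by (metis parameters_equal)

section \<open>A continuous one-parameter family\<close>

text \<open>The bracket is affine in \<open>s\<close>, hence continuous as a curve in the space of bilinear maps.\<close>

lemma continuous_family:
  obtains \<mu> :: "real \<Rightarrow> (real ^ 'n) \<Rightarrow>\<^sub>L (real ^ 'n) \<Rightarrow>\<^sub>L (real ^ 'n)"
  where "continuous_on UNIV \<mu>" and "\<And>s. bracket_of (\<mu> s) = br s"
proof -
  have bb: "bounded_bilinear (br s)" for s
    using bilinear_br by (simp add: bilinear_conv_bounded_bilinear)
  define m where "m s = Blinfun (bounded_bilinear.prod_right (br s))" for s
  have m: "bracket_of (m s) x y = br s x y" for s x y
    by (simp add: m_def bounded_linear_Blinfun_apply bounded_bilinear.bounded_linear_prod_right[OF bb]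
        bounded_bilinear.prod_right.rep_eq[OF bb])
  define \<mu> where "\<mu> s = m 0 + s *\<^sub>R (m 1 - m 0)" for s
  have "bracket_of (\<mu> s) x y = br s x y" for s x y
  proof -
    have "bracket_of (\<mu> s) x y = br 0 x y + s *\<^sub>R (br 1 x y - br 0 x y)"
      by (simp add: \<mu>_def blinfun.add_left blinfun.diff_left blinfun.scaleR_left m)
    also have "\<dots> = br s x y"
      by (rule coordinate_eqI') (simp_all add: algebra_simps)
    finally show ?thesis .
  qed
  then have "bracket_of (\<mu> s) = br s" for s
    by (intro ext)
  moreover have "continuous_on UNIV \<mu>"
    unfolding \<mu>_def by (intro continuous_intros)
  ultimately show ?thesis using that by blast
qed

end

theorem theorem1p4:
  assumes "CARD('n::finite) \<ge> 8"
  shows "\<exists>\<mu> :: real \<Rightarrow> (real ^ 'n) \<Rightarrow>\<^sub>L (real ^ 'n) \<Rightarrow>\<^sub>L (real ^ 'n).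
      continuous_on UNIV \<mu> \<and>
      (\<forall>s. lie_bracket (bracket_of (\<mu> s)) \<and>
           nilpotent_bracket (bracket_of (\<mu> s)) \<and>
           indecomposable (bracket_of (\<mu> s)) \<and>
           positively_graded (bracket_of (\<mu> s)) \<and>
           \<not> soliton (bracket_of (\<mu> s))) \<and>
      (\<forall>s t. s \<noteq> t \<longrightarrow> \<not> lie_isomorphic (bracket_of (\<mu> s)) (bracket_of (\<mu> t)))"
proof -
  obtain ax :: "nat \<Rightarrow> 'n" where "bij_betw ax {1..CARD('n)} UNIV"
    using ex_bij_betw_nat_finite_1[of "UNIV :: 'n set"] by auto
  then interpret enumerated_axes "CARD('n)" ax
    using assms by unfold_locales
  obtain \<mu> :: "real \<Rightarrow> (real ^ 'n) \<Rightarrow>\<^sub>L (real ^ 'n) \<Rightarrow>\<^sub>L (real ^ 'n)"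
    where \<mu>: "continuous_on UNIV \<mu>" "\<And>s. bracket_of (\<mu> s) = br s"
    using continuous_family by blast
  show ?thesis
    by (intro exI[of _ \<mu>] conjI allI impI)
      (simp_all add: \<mu> lie_bracket_br nilpotent_br indecomposable_br positively_graded_br
        not_soliton_br not_isomorphic_br)
qed

end
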